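(* Let $Prop$ be a nonempty finite set of propositional variables. There is no binary connective $>$ such that, when the team semantics of the language $[\neg,\wedge,\vee,\nabla]$ is extended to the language $[\neg,\wedge,\vee,\nabla,>]$ (in which $>$ may be applied to arbitrary formulas, and the semantic clauses of $\neg,\wedge,\vee,\nabla$ remain as given for all formulas of the extended language), all of the following hold: (i) every formula of $[\neg,\wedge,\vee,\nabla,>]$ is union closed; (ii) Modus Ponens: $\varphi,\varphi>\psi\models\psi$ for all formulas $\varphi,\psi$ of the extended language; (iii) Deduction Theorem: for every set $\Gamma\cup\{\varphi,\psi\}$ of formulas of the extended language, if $\Gamma,\varphi\models\psi$ then $\Gamma\models\varphi>\psi$.
   Context: A valuation is a function $v:Prop\to\{0,1\}$; a team is a set of valuations. Formulas of $[\neg,\wedge,\vee,\nabla]$ are generated by $\varphi::=p\mid\neg\varphi\mid\varphi\wedge\varphi\mid\varphi\vee\varphi\mid\nabla\varphi$ with $p\in Prop$. Team semantics: $T\models p$ iff $v(p)=1$ for all $v\in T$; $T\models\neg\varphi$ iff $\{v\}\not\models\varphi$ for all $v\in T$; $T\models\varphi\wedge\psi$ iff $T\models\varphi$ and $T\models\psi$; $T\models\varphi\vee\psi$ iff there are $T_1,T_2$ with $T=T_1\cup T_2$, $T_1\models\varphi$, $T_2\models\psi$; $T\models\nabla\varphi$ iff $T=\emptyset$ or there is a nonempty $S\subseteq T$ with $S\models\varphi$. A formula is union closed if $T\models\varphi$ and $S\models\varphi$ imply $S\cup T\models\varphi$. $\Gamma\models\psi$ means every team satisfying all formulas of $\Gamma$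 satisfies $\psi$. *)

theory Defs
  imports Main
begin

type_synonym 'p valuation = "'p \<Rightarrow> bool"
type_synonym 'p team = "'p valuation set"

datatype 'p form =
    Var 'p
  | Neg "'p form"
  | And "'p form" "'p form"
  | Or "'p form" "'p form"
  | Nabla "'p form"
  | Cond "'p form" "'p form"

text \<open>
  A satisfaction relation on the extended language whose clauses for all connectives except
  \<open>Cond\<close> are the given ones. Nothing is required of \<open>Cond\<close>, so every possible semantic clause
  for it is covered, compositional or not.
\<close>

definition extends_team_semantics :: "('p team \<Rightarrow> 'p form \<Rightarrow> bool) \<Rightarrow> bool" where
  "extends_team_semantics sat \<longleftrightarrow>
     (\<forall>T p. sat T (Var p) \<longleftrightarrow> (\<forall>v\<in>T. v p)) \<and>
     (\<forall>T \<phi>. sat T (Neg \<phi>) \<longleftrightarrow> (\<forall>v\<in>T. \<not> sat {v} \<phi>)) \<and>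
     (\<forall>T \<phi> \<psi>. sat T (And \<phi> \<psi>) \<longleftrightarrow> sat T \<phi> \<and> sat T \<psi>) \<and>
     (\<forall>T \<phi> \<psi>. sat T (Or \<phi> \<psi>) \<longleftrightarrow> (\<exists>T1 T2. T = T1 \<union> T2 \<and> sat T1 \<phi> \<and> sat T2 \<psi>)) \<and>
     (\<forall>T \<phi>. sat T (Nabla \<phi>) \<longleftrightarrow> T = {} \<or> (\<exists>S. S \<noteq> {} \<and> S \<subseteq> T \<and> sat S \<phi>))"

definition union_closed :: "('p team \<Rightarrow> 'p form \<Rightarrow> bool) \<Rightarrow> 'p form \<Rightarrow> bool" where
  "union_closed sat \<phi> \<longleftrightarrow> (\<forall>S T. sat T \<phi> \<and> sat S \<phi> \<longrightarrow> sat (S \<union> T) \<phi>)"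

definition entails :: "('p team \<Rightarrow> 'p form \<Rightarrow> bool) \<Rightarrow> 'p form set \<Rightarrow> 'p form \<Rightarrow> bool" where
  "entails sat \<Gamma> \<psi> \<longleftrightarrow> (\<forall>T. (\<forall>\<phi>\<in>\<Gamma>. sat T \<phi>) \<longrightarrow> sat T \<psi>)"

definition modus_ponens :: "('p team \<Rightarrow> 'p form \<Rightarrow> bool) \<Rightarrow> bool" where
  "modus_ponens sat \<longleftrightarrow> (\<forall>\<phi> \<psi>. entails sat {\<phi>, Cond \<phi> \<psi>} \<psi>)"

definition deduction_theorem :: "('p team \<Rightarrow> 'p form \<Rightarrow> bool) \<Rightarrow> bool" where
  "deduction_theorem sat \<longleftrightarrow>
     (\<forall>\<Gamma> \<phi> \<psi>. entails sat (\<Gamma> \<union> {\<phi>}) \<psi> \<longrightarrow> entails sat \<Gamma> (Cond \<phi> \<psi>))"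

end

theory Submission
  imports Defs
begin

text \<open>
  Let \<open>\<phi> = \<nabla>p \<and> \<nabla>\<not>p\<close> and \<open>\<psi> = p \<and> \<not>p\<close>, which only the empty team satisfies. Both \<open>p, \<phi> \<Turnstile> \<psi>\<close> and
  \<open>\<not>p, \<phi> \<Turnstile> \<psi>\<close>, so by the Deduction Theorem a singleton team satisfies \<open>\<phi> > \<psi>\<close> whichever value
  it gives to \<open>p\<close>. By union closure so does a pair of valuations that differ at \<open>p\<close>; this pair
  satisfies \<open>\<phi>\<close>, hence by Modus Ponens \<open>\<psi>\<close>, which is absurd.
\<close>

theorem theorem1:
  "\<not> (\<exists>sat :: 'p::finite team \<Rightarrow> 'p form \<Rightarrow> bool.
        extends_team_semantics sat \<and>
        (\<forall>\<phi>. union_closed sat \<phi>) \<and>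
        modus_ponens sat \<and>
        deduction_theorem sat)"
proof
  assume "\<exists>sat :: 'p team \<Rightarrow> 'p form \<Rightarrow> bool.
        extends_team_semantics sat \<and> (\<forall>\<phi>. union_closed sat \<phi>) \<and>
        modus_ponens sat \<and> deduction_theorem sat"
  then obtain sat :: "'p team \<Rightarrow> 'p form \<Rightarrow> bool" where
    ext: "extends_team_semantics sat" and uc: "\<And>\<phi>. union_closed sat \<phi>" and
    mp: "modus_ponens sat" and dt: "deduction_theorem sat"
    by blast
  have sat_Var: "sat T (Var p) \<longleftrightarrow> (\<forall>v\<in>T. v p)" for T p
    using ext unfolding extends_team_semantics_def by blast
  have sat_Neg: "sat T (Neg \<phi>) \<longleftrightarrow> (\<forall>v\<in>T. \<not> sat {v} \<phi>)" for T \<phi>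
    using ext unfolding extends_team_semantics_def by blast
  have sat_And: "sat T (And \<phi> \<psi>) \<longleftrightarrow> sat T \<phi> \<and> sat T \<psi>" for T \<phi> \<psi>
    using ext unfolding extends_team_semantics_def by blast
  have sat_Nabla: "sat T (Nabla \<phi>) \<longleftrightarrow> T = {} \<or> (\<exists>S. S \<noteq> {} \<and> S \<subseteq> T \<and> sat S \<phi>)" for T \<phi>
    using ext unfolding extends_team_semantics_def by blast
  note sat_simps = sat_Var sat_Neg sat_And sat_Nabla
  \<comment> \<open>Any variable serves; \<open>undefined\<close> picks one, since types are
    nonempty.\<close>
  define p :: 'p where "p = undefined"
  define \<phi> where "\<phi> = And (Nabla (Var p)) (Nabla (Neg (Var p)))"
  define \<psi> where "\<psi> = And (Var p) (Neg (Var p))"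
  \<comment> \<open>Constant valuations differ at every variable, hence at \<open>p\<close>.\<close>
  define a b :: "'p valuation" where "a = (\<lambda>_. True)" and "b = (\<lambda>_. False)"
  \<comment> \<open>In a nonempty team, one conjunct of \<open>\<phi>\<close> gives a nonempty
    subteam that contradicts the other premise. So the team is empty and satisfies
    \<open>\<psi>\<close> vacuously.\<close>
  have "entails sat ({Var p} \<union> {\<phi>}) \<psi>" "entails sat ({Neg (Var p)} \<union> {\<phi>}) \<psi>"
    unfolding entails_def \<phi>_def \<psi>_def by (auto simp: sat_simps)
  then have "entails sat {Var p} (Cond \<phi> \<psi>)" "entails sat {Neg (Var p)} (Cond \<phi> \<psi>)"
    using dt unfolding deduction_theorem_def by blast+
  moreover have "sat {a} (Var p)" "sat {b} (Neg (Var p))"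
    by (simp_all add: sat_simps a_def b_def)
  ultimately have "sat {a} (Cond \<phi> \<psi>)" "sat {b} (Cond \<phi> \<psi>)"
    unfolding entails_def by blast+
  then have "sat ({a} \<union> {b}) (Cond \<phi> \<psi>)"
    using uc unfolding union_closed_def by blast
  moreover have "sat ({a} \<union> {b}) \<phi>"
  proof -
    \<comment> \<open>Each singleton is the nonempty subteam that one \<open>Nabla\<close> asks
      for.\<close>
    have "{a} \<noteq> {} \<and> {a} \<subseteq> {a} \<union> {b} \<and> sat {a} (Var p)"
      "{b} \<noteq> {} \<and> {b} \<subseteq> {a} \<union> {b} \<and> sat {b} (Neg (Var p))"
      using \<open>sat {a} (Var p)\<close> \<open>sat {b} (Neg (Var p))\<close> by auto
    then show ?thesis
      unfolding \<phi>_def sat_And sat_Nabla by blast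
  qed
  ultimately have "sat ({a} \<union> {b}) \<psi>"
    using mp unfolding modus_ponens_def entails_def by blast
  then show False
    by (simp add: \<psi>_def sat_simps a_def b_def)
qed

end
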